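(* Let $\varphi$ be a formula of $\mathcal{DTL}$ and suppose $\varphi$ is satisfied in a $\varphi$-typed non-deterministic quasimodel $\mathfrak D=\langle W,R,g,t\rangle$. Then there exists $\vec w^{\,*}\in W^g$ such that $\langle\lim\mathfrak D,\vec w^{\,*}\rangle\models\varphi$.
   Context: Language and models. Formulas of $\mathcal{DTL}$ are built from propositional variables with $\wedge,\neg$ and unary modalities $\Box,\bigcirc,\ast$. A dynamic topological model is $\langle X,\mathcal T,f,V\rangle$ with $\langle X,\mathcal T\rangle$ a topological space, $f:X\to X$ continuous, $V$ assigning subsets of $X$ to variables, extended by $V(\alpha\wedge\beta)=V(\alpha)\cap V(\beta)$, $V(\neg\alpha)=X\setminus V(\alpha)$, $V(\Box\alpha)=V(\alpha)^\circ$ (interior), $V(\bigcirc\alpha)=f^{-1}(V(\alpha))$, $V(\ast\alpha)=\bigcap_{n\ge0}f^{-n}(V(\alpha))$. $\langle\mathfrak M,x\rangle\models\psi$ means $x\in V(\psi)$. Types and frames. $\mathrm{sub}(\varphi)$ is the set of subformulas of $\varphi$ and $\mathrm{sub}_\pm(\varphi)=\mathrm{sub}(\varphi)\cup\{\neg\psi:\psi\in\mathrm{sub}(\varphi)\}$, where $\psi$ and $\neg\neg\psi$ are identified. A $\varphi$-type is a set $\mathbf t\subseteq\mathrm{sub}_\pm(\varphi)$ such that for all $\psi\in\mathrm{sub}_\pm(\varphi)$, $\psi\notin\mathbf t\Leftrightarrow\neg\psi\in\mathbf t$, and for all $\psi_1\wedge\psi_2\in\mathrm{sub}_\pm(\varphi)$,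 $\psi_1\wedge\psi_2\in\mathbf t\Leftrightarrow\psi_1,\psi_2\in\mathbf t$. A $\varphi$-typed Kripke frame is $\langle W,R,t\rangle$ with $R$ a transitive reflexive relation on $W$ and $t$ assigning a $\varphi$-type to each $w\in W$ such that (for $\Box\psi\in\mathrm{sub}_\pm(\varphi)$) $\Box\psi\in t(w)\Leftrightarrow\forall v(Rwv\Rightarrow\psi\in t(v))$. $W$ carries the topology whose open sets are the sets upward closed under $R$; a relation is continuous if preimages of open sets are open. Quasimodels. A pair $(\mathbf t,\mathbf s)$ of $\varphi$-types is sensible if for all $\bigcirc\psi\in\mathrm{sub}(\varphi)$, $\bigcirc\psi\in\mathbf t\Leftrightarrow\psi\in\mathbf s$, and for all $\ast\psi\in\mathrm{sub}(\varphi)$, $\ast\psi\in\mathbf t\Leftrightarrow(\psi\in\mathbf t$ and $\ast\psi\in\mathbf s)$. A relation $g\subseteq W\times W$ is sensible if it is continuous, $g(w)\ne\varnothing$ for all $w$, and $(t(w),t(v))$ is sensible whenever $gwv$. It is $\omega$-sensible if moreover for all $\ast\psi\in\mathrm{sub}(\varphi)$ and $w\in W$: $\neg\ast\psi\in t(w)$ iff there are $v\in W$, $N\ge0$ with $g^Nwv$ and $\neg\psi\in t(v)$. A $\varphi$-typed non-deterministic quasimodel is a $\varphi$-typed Kripke frame $\langle W,R,t\rangle$ with an $\omega$-sensible relation $g$ on $W$; it satisfies $\varphi$ if $\varphi\in t(w)$ for some $w\in W$. Limit model. A path is a finite or infinite sequence $\langle w_n\rangle$ with $gw_nw_{n+1}$.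 An infinite path $\vec w=\langle w_n\rangle_{n\ge0}$ is realizing if for all $n\ge0$ and $\neg\ast\psi\in t(w_n)$ (with $\ast\psi\in\mathrm{sub}(\varphi)$) there is $K\ge n$ with $\neg\psi\in t(w_K)$. $W^g$ is the set of realizing paths. $\mathcal T^R$ is the topology on $W^g$ generated by the basis of sets $R_N(\vec w)=\{\vec v\in W^g:\forall n\le N,\ Rw_nv_n\}$ ($\vec w\in W^g$, $N\ge0$). $\sigma:W^g\to W^g$ is the shift $\sigma(\langle w_n\rangle_{n\ge0})=\langle w_{n+1}\rangle_{n\ge0}$. $V^t(p)=\{\vec w\in W^g:p\in t(w_0)\}$ for variables $p$. The limit model is $\lim\mathfrak D=\langle W^g,\mathcal T^R,\sigma,V^t\rangle$. *)

theory Defs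
  imports "HOL-Analysis.Abstract_Topology"
begin

datatype 'p fm =
    Var 'p
  | And "'p fm" "'p fm"
  | Neg "'p fm"
  | Box "'p fm"
  | Next "'p fm"
  | Star "'p fm"

record ('x, 'p) dtmodel =
  space :: "'x topology"
  fn :: "'x \<Rightarrow> 'x"
  val :: "'p \<Rightarrow> 'x set"

definition dynamic_topological_model :: "('x, 'p) dtmodel \<Rightarrow> bool" where
  "dynamic_topological_model M \<longleftrightarrow>
     continuous_map (space M) (space M) (fn M) \<and> (\<forall>p. val M p \<subseteq> topspace (space M))"

fun ext :: "('x, 'p) dtmodel \<Rightarrow> 'p fm \<Rightarrow> 'x set" where
  "ext M (Var p) = val M p"
| "ext M (And \<alpha> \<beta>) = ext M \<alpha> \<inter> ext M \<beta>"
| "ext M (Neg \<alpha>) = topspace (space M) - ext M \<alpha>"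
| "ext M (Box \<alpha>) = space M interior_of ext M \<alpha>"
| "ext M (Next \<alpha>) = {x \<in> topspace (space M). fn M x \<in> ext M \<alpha>}"
| "ext M (Star \<alpha>) = (\<Inter>n. {x \<in> topspace (space M). (fn M ^^ n) x \<in> ext M \<alpha>})"

definition satisfies :: "('x, 'p) dtmodel \<Rightarrow> 'x \<Rightarrow> 'p fm \<Rightarrow> bool" where
  "satisfies M x \<psi> \<longleftrightarrow> x \<in> ext M \<psi>"

fun sub :: "'p fm \<Rightarrow> 'p fm set" where
  "sub (Var p) = {Var p}"
| "sub (And \<alpha> \<beta>) = insert (And \<alpha> \<beta>) (sub \<alpha> \<union> sub \<beta>)"
| "sub (Neg \<alpha>) = insert (Neg \<alpha>) (sub \<alpha>)"
| "sub (Box \<alpha>) = insert (Box \<alpha>) (sub \<alpha>)"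
| "sub (Next \<alpha>) = insert (Next \<alpha>) (sub \<alpha>)"
| "sub (Star \<alpha>) = insert (Star \<alpha>) (sub \<alpha>)"

text \<open>
  A formula is identified with its double negation. We represent each class of the equivalence
  relation generated by this identification by its member without a leading double negation.
  The set \<open>sub_pm \<phi>\<close>, and hence every type, consists of such representatives;
  \<open>\<psi> \<in>\<^sub>d t\<close> means that the class of \<open>\<psi>\<close> belongs to \<open>t\<close>.
\<close>

fun dn :: "'p fm \<Rightarrow> 'p fm" where
  "dn (Neg (Neg \<psi>)) = dn \<psi>"
| "dn \<psi> = \<psi>"

abbreviation mem_dn :: "'p fm \<Rightarrow> 'p fm set \<Rightarrow> bool" (infix \<open>\<in>\<^sub>d\<close> 50) where
  "\<psi> \<in>\<^sub>d t \<equiv> dn \<psi> \<in> t"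

definition sub_pm :: "'p fm \<Rightarrow> 'p fm set" where
  "sub_pm \<phi> = dn ` (sub \<phi> \<union> {Neg \<psi> | \<psi>. \<psi> \<in> sub \<phi>})"

definition is_type :: "'p fm \<Rightarrow> 'p fm set \<Rightarrow> bool" where
  "is_type \<phi> t \<longleftrightarrow> t \<subseteq> sub_pm \<phi> \<and>
     (\<forall>\<psi>. \<psi> \<in>\<^sub>d sub_pm \<phi> \<longrightarrow> (\<not> \<psi> \<in>\<^sub>d t \<longleftrightarrow> Neg \<psi> \<in>\<^sub>d t)) \<and>
     (\<forall>\<psi>\<^sub>1 \<psi>\<^sub>2. And \<psi>\<^sub>1 \<psi>\<^sub>2 \<in>\<^sub>d sub_pm \<phi> \<longrightarrow>
        (And \<psi>\<^sub>1 \<psi>\<^sub>2 \<in>\<^sub>d t \<longleftrightarrow> \<psi>\<^sub>1 \<in>\<^sub>d t \<and> \<psi>\<^sub>2 \<in>\<^sub>d t))"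

record ('w, 'p) frame =
  worlds :: "'w set"
  acc :: "('w \<times> 'w) set"
  type_of :: "'w \<Rightarrow> 'p fm set"

definition typed_frame :: "'p fm \<Rightarrow> ('w, 'p, 'e) frame_scheme \<Rightarrow> bool" where
  "typed_frame \<phi> F \<longleftrightarrow>
     acc F \<subseteq> worlds F \<times> worlds F \<and> refl_on (worlds F) (acc F) \<and> trans (acc F) \<and>
     (\<forall>w\<in>worlds F. is_type \<phi> (type_of F w)) \<and>
     (\<forall>\<psi>. Box \<psi> \<in>\<^sub>d sub_pm \<phi> \<longrightarrow> (\<forall>w\<in>worlds F.
        Box \<psi> \<in>\<^sub>d type_of F w \<longleftrightarrow> (\<forall>v. (w, v) \<in> acc F \<longrightarrow> \<psi> \<in>\<^sub>d type_of F v)))"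

definition upset_topology :: "'w set \<Rightarrow> ('w \<times> 'w) set \<Rightarrow> 'w topology" where
  "upset_topology W R = topology (\<lambda>U. U \<subseteq> W \<and> (\<forall>w\<in>U. \<forall>v\<in>W. (w, v) \<in> R \<longrightarrow> v \<in> U))"

lemma openin_upset_topology:
  "openin (upset_topology W R) U \<longleftrightarrow> U \<subseteq> W \<and> (\<forall>w\<in>U. \<forall>v\<in>W. (w, v) \<in> R \<longrightarrow> v \<in> U)"
proof -
  have "istopology (\<lambda>U. U \<subseteq> W \<and> (\<forall>w\<in>U. \<forall>v\<in>W. (w, v) \<in> R \<longrightarrow> v \<in> U))"
    unfolding istopology_def by blast
  then show ?thesis
    by (simp add: upset_topology_def)
qed

definition sensible_pair :: "'p fm \<Rightarrow> 'p fm set \<Rightarrow> 'p fm set \<Rightarrow> bool" where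
  "sensible_pair \<phi> t s \<longleftrightarrow>
     (\<forall>\<psi>. Next \<psi> \<in> sub \<phi> \<longrightarrow> (Next \<psi> \<in>\<^sub>d t \<longleftrightarrow> \<psi> \<in>\<^sub>d s)) \<and>
     (\<forall>\<psi>. Star \<psi> \<in> sub \<phi> \<longrightarrow> (Star \<psi> \<in>\<^sub>d t \<longleftrightarrow> \<psi> \<in>\<^sub>d t \<and> Star \<psi> \<in>\<^sub>d s))"

definition continuous_rel :: "'x topology \<Rightarrow> ('x \<times> 'x) set \<Rightarrow> bool" where
  "continuous_rel T g \<longleftrightarrow> (\<forall>U. openin T U \<longrightarrow> openin T (g\<inverse> `` U))"

record ('w, 'p) quasi = "('w, 'p) frame" +
  step :: "('w \<times> 'w) set"

definition sensible :: "'p fm \<Rightarrow> ('w, 'p) quasi \<Rightarrow> bool" where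
  "sensible \<phi> D \<longleftrightarrow>
     step D \<subseteq> worlds D \<times> worlds D \<and>
     continuous_rel (upset_topology (worlds D) (acc D)) (step D) \<and>
     (\<forall>w\<in>worlds D. step D `` {w} \<noteq> {}) \<and>
     (\<forall>w v. (w, v) \<in> step D \<longrightarrow> sensible_pair \<phi> (type_of D w) (type_of D v))"

definition omega_sensible :: "'p fm \<Rightarrow> ('w, 'p) quasi \<Rightarrow> bool" where
  "omega_sensible \<phi> D \<longleftrightarrow> sensible \<phi> D \<and>
     (\<forall>\<psi>. Star \<psi> \<in> sub \<phi> \<longrightarrow> (\<forall>w\<in>worlds D.
        Neg (Star \<psi>) \<in>\<^sub>d type_of D w \<longleftrightarrow>
        (\<exists>v\<in>worlds D. \<exists>N. (w, v) \<in> step D ^^ N \<and> Neg \<psi> \<in>\<^sub>d type_of D v)))"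

definition quasimodel :: "'p fm \<Rightarrow> ('w, 'p) quasi \<Rightarrow> bool" where
  "quasimodel \<phi> D \<longleftrightarrow> typed_frame \<phi> D \<and> omega_sensible \<phi> D"

definition satisfied_in :: "'p fm \<Rightarrow> ('w, 'p) quasi \<Rightarrow> bool" where
  "satisfied_in \<phi> D \<longleftrightarrow> (\<exists>w\<in>worlds D. \<phi> \<in>\<^sub>d type_of D w)"

definition infinite_path :: "('w \<times> 'w) set \<Rightarrow> (nat \<Rightarrow> 'w) \<Rightarrow> bool" where
  "infinite_path g w \<longleftrightarrow> (\<forall>n. (w n, w (Suc n)) \<in> g)"

definition realizing :: "'p fm \<Rightarrow> ('w, 'p) quasi \<Rightarrow> (nat \<Rightarrow> 'w) \<Rightarrow> bool" where
  "realizing \<phi> D w \<longleftrightarrow> infinite_path (step D) w \<and>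
     (\<forall>n \<psi>. Star \<psi> \<in> sub \<phi> \<longrightarrow> Neg (Star \<psi>) \<in>\<^sub>d type_of D (w n) \<longrightarrow>
        (\<exists>K\<ge>n. Neg \<psi> \<in>\<^sub>d type_of D (w K)))"

definition realizing_paths :: "'p fm \<Rightarrow> ('w, 'p) quasi \<Rightarrow> (nat \<Rightarrow> 'w) set" where
  "realizing_paths \<phi> D = {w. realizing \<phi> D w}"

definition basic_open :: "'p fm \<Rightarrow> ('w, 'p) quasi \<Rightarrow> nat \<Rightarrow> (nat \<Rightarrow> 'w) \<Rightarrow> (nat \<Rightarrow> 'w) set" where
  "basic_open \<phi> D N w = {v \<in> realizing_paths \<phi> D. \<forall>n\<le>N. (w n, v n) \<in> acc D}"

definition limit_topology :: "'p fm \<Rightarrow> ('w, 'p) quasi \<Rightarrow> (nat \<Rightarrow> 'w) topology" where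
  "limit_topology \<phi> D =
     topology_generated_by {basic_open \<phi> D N w | N w. w \<in> realizing_paths \<phi> D}"

definition shift :: "(nat \<Rightarrow> 'w) \<Rightarrow> nat \<Rightarrow> 'w" where
  "shift w = (\<lambda>n. w (Suc n))"

definition limit_model :: "'p fm \<Rightarrow> ('w, 'p) quasi \<Rightarrow> (nat \<Rightarrow> 'w, 'p) dtmodel" where
  "limit_model \<phi> D =
     \<lparr>space = limit_topology \<phi> D,
      fn = shift,
      val = (\<lambda>p. {w \<in> realizing_paths \<phi> D. Var p \<in>\<^sub>d type_of D (w 0)})\<rparr>"

text \<open>
  For a quasimodel the generating sets really form a basis of a topology on the set of realizing
  paths, and the limit model is a dynamic topological model.
\<close>

lemma basic_open_self:
  assumes "quasimodel \<phi> D" "w \<in> realizing_paths \<phi> D"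
  shows "w \<in> basic_open \<phi> D N w"
proof -
  have "w n \<in> worlds D" for n
    using assms unfolding quasimodel_def omega_sensible_def sensible_def realizing_paths_def
      realizing_def infinite_path_def by blast
  then show ?thesis
    using assms unfolding quasimodel_def typed_frame_def basic_open_def refl_on_def by blast
qed

lemma basic_open_mono:
  assumes "quasimodel \<phi> D" "v \<in> basic_open \<phi> D N w" "N \<le> M"
  shows "basic_open \<phi> D M v \<subseteq> basic_open \<phi> D N w"
proof -
  have "trans (acc D)"
    using assms(1) by (simp add: quasimodel_def typed_frame_def)
  then show ?thesis
    using assms(2,3) unfolding basic_open_def by (auto intro: transD dest: order_trans)
qed

lemma openin_limit_topology:
  assumes "quasimodel \<phi> D"
  shows "openin (limit_topology \<phi> D) U \<longleftrightarrow>
    U \<subseteq> realizing_paths \<phi> D \<and> (\<forall>w\<in>U. \<exists>N. basic_open \<phi> D N w \<subseteq> U)" (is "?L \<longleftrightarrow> ?R")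
proof
  let ?B = "{basic_open \<phi> D N w | N w. w \<in> realizing_paths \<phi> D}"
  assume ?L
  then have "generate_topology_on ?B U"
    by (simp add: limit_topology_def openin_topology_generated_by_iff)
  then show ?R
  proof (induction rule: generate_topology_on.induct)
    case Empty
    show ?case by simp
  next
    case (Int a b)
    have "\<exists>N. basic_open \<phi> D N w \<subseteq> a \<inter> b" if "w \<in> a \<inter> b" for w
    proof -
      obtain N M where NM: "basic_open \<phi> D N w \<subseteq> a" "basic_open \<phi> D M w \<subseteq> b"
        using Int.IH \<open>w \<in> a \<inter> b\<close> by (meson IntD1 IntD2)
      have "basic_open \<phi> D (max N M) w \<subseteq> basic_open \<phi> D N w \<inter> basic_open \<phi> D M w"
        by (auto simp: basic_open_def)
      with NM show ?thesis by (meson Int_mono order_trans)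
    qed
    then show ?case using Int.IH(1) by (simp add: le_infI1)
  next
    case (UN K)
    have "\<exists>N. basic_open \<phi> D N w \<subseteq> \<Union>K" if "w \<in> \<Union>K" for w
    proof -
      obtain k where k: "k \<in> K" "w \<in> k" using \<open>w \<in> \<Union>K\<close> by (rule UnionE)
      then obtain N where "basic_open \<phi> D N w \<subseteq> k" using UN.IH[OF k(1)] by auto
      then show ?thesis using Union_upper[OF k(1)] by (meson order_trans)
    qed
    moreover have "\<Union>K \<subseteq> realizing_paths \<phi> D"
      by (rule Union_least) (simp add: UN.IH)
    ultimately show ?case by simp
  next
    case (Basis s)
    then obtain N w where s: "s = basic_open \<phi> D N w" by auto
    have "s \<subseteq> realizing_paths \<phi> D" by (auto simp: s basic_open_def)
    moreover have "basic_open \<phi> D N v \<subseteq> s" if "v \<in> s" for v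
      using basic_open_mono[OF assms, of v N w N] \<open>v \<in> s\<close> s by simp
    ultimately show ?case by auto
  qed
next
  assume R: ?R
  show ?L
  proof (subst openin_subopen, intro ballI)
    fix w assume "w \<in> U"
    with R obtain N where N: "basic_open \<phi> D N w \<subseteq> U" and w: "w \<in> realizing_paths \<phi> D"
      by (meson subsetD)
    have "openin (limit_topology \<phi> D) (basic_open \<phi> D N w)"
      unfolding limit_topology_def by (rule topology_generated_by_Basis) (use w in auto)
    with N basic_open_self[OF assms w] show "\<exists>T. openin (limit_topology \<phi> D) T \<and> w \<in> T \<and> T \<subseteq> U"
      by meson
  qed
qed

lemma topspace_limit_topology:
  assumes "quasimodel \<phi> D"
  shows "topspace (limit_topology \<phi> D) = realizing_paths \<phi> D"
proof
  show "topspace (limit_topology \<phi> D) \<subseteq> realizing_paths \<phi> D"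
    using openin_limit_topology[OF assms] openin_topspace by blast
  show "realizing_paths \<phi> D \<subseteq> topspace (limit_topology \<phi> D)"
    by (rule openin_subset) (simp add: openin_limit_topology[OF assms] basic_open_def subset_iff)
qed

lemma shift_realizing:
  assumes "w \<in> realizing_paths \<phi> D"
  shows "shift w \<in> realizing_paths \<phi> D"
proof -
  have "\<exists>K\<ge>n. Neg \<psi> \<in>\<^sub>d type_of D (w (Suc K))"
    if "Star \<psi> \<in> sub \<phi>" "Neg (Star \<psi>) \<in>\<^sub>d type_of D (w (Suc n))" for n \<psi>
  proof -
    obtain K where "K \<ge> Suc n" "Neg \<psi> \<in>\<^sub>d type_of D (w K)"
      using assms \<open>Star \<psi> \<in> sub \<phi>\<close> \<open>Neg (Star \<psi>) \<in>\<^sub>d type_of D (w (Suc n))\<close>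
      unfolding realizing_paths_def realizing_def by blast
    then show ?thesis by (metis Suc_le_D Suc_le_mono)
  qed
  then show ?thesis
    using assms by (auto simp: realizing_paths_def realizing_def infinite_path_def shift_def)
qed

lemma dynamic_topological_model_limit_model:
  assumes "quasimodel \<phi> D"
  shows "dynamic_topological_model (limit_model \<phi> D)"
proof -
  have "openin (limit_topology \<phi> D) {w \<in> realizing_paths \<phi> D. shift w \<in> U}"
    if U: "openin (limit_topology \<phi> D) U" for U
  proof -
    have "\<exists>N. basic_open \<phi> D N w \<subseteq> {w \<in> realizing_paths \<phi> D. shift w \<in> U}"
      if w: "w \<in> realizing_paths \<phi> D" "shift w \<in> U" for w
    proof -
      obtain N where N: "basic_open \<phi> D N (shift w) \<subseteq> U"
        using U w unfolding openin_limit_topology[OF assms] by blast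
      have "shift v \<in> basic_open \<phi> D N (shift w)" if "v \<in> basic_open \<phi> D (Suc N) w" for v
        using that by (auto simp: basic_open_def shift_realizing) (simp add: shift_def)
      with N have "basic_open \<phi> D (Suc N) w \<subseteq> {w \<in> realizing_paths \<phi> D. shift w \<in> U}"
        by (auto simp: basic_open_def)
      then show ?thesis by blast
    qed
    then show ?thesis unfolding openin_limit_topology[OF assms] by auto
  qed
  then show ?thesis
    by (auto simp: dynamic_topological_model_def limit_model_def continuous_map_def
        topspace_limit_topology[OF assms] shift_realizing)
qed

end

(* The type of the first world of a realizing path decides which subformulas of phi hold at the
   path in the limit model. The only delicate case of this truth lemma is Box: if R relates w_0
   to v_0, continuity of g lets one copy any initial segment of a path from w_0 above itself,
   starting at v_0, and the copy has to be continued to a realizing path. This is possible because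
   phi has finitely many subformulas: from every world a finite path fulfils all the eventualities
   pending there, an eventuality that is not fulfilled persists, and so concatenating such finite
   paths fulfils every eventuality. *)

theory Submission
  imports Defs
begin

section \<open>Subformulas\<close>

lemma sub_refl: "\<psi> \<in> sub \<psi>"
  by (cases \<psi>) auto

lemma sub_trans: "\<psi> \<in> sub \<chi> \<Longrightarrow> \<chi> \<in> sub \<phi> \<Longrightarrow> \<psi> \<in> sub \<phi>"
  by (induction \<phi>) auto

lemma sub_immediate:
  "And \<alpha> \<beta> \<in> sub \<phi> \<Longrightarrow> \<alpha> \<in> sub \<phi>" "And \<alpha> \<beta> \<in> sub \<phi> \<Longrightarrow> \<beta> \<in> sub \<phi>"
  "Neg \<alpha> \<in> sub \<phi> \<Longrightarrow> \<alpha> \<in> sub \<phi>" "Box \<alpha> \<in> sub \<phi> \<Longrightarrow> \<alpha> \<in> sub \<phi>"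
  "Next \<alpha> \<in> sub \<phi> \<Longrightarrow> \<alpha> \<in> sub \<phi>" "Star \<alpha> \<in> sub \<phi> \<Longrightarrow> \<alpha> \<in> sub \<phi>"
  by (rule sub_trans[rotated], assumption, simp add: sub_refl)+

lemma finite_sub: "finite (sub \<phi>)"
  by (induction \<phi>) auto

lemma finite_Star_sub: "finite {\<psi>. Star \<psi> \<in> sub \<phi>}"
  using finite_vimageI[OF finite_sub[of \<phi>], of Star] by (simp add: vimage_def inj_def)

section \<open>Finite paths and their concatenation\<close>

lemma relpow_imp_successively:
  assumes "(w, v) \<in> g ^^ N"
  shows "\<exists>ys. successively (\<lambda>x y. (x, y) \<in> g) (w # ys) \<and> last (w # ys) = v"
  using assms
proof (induction N arbitrary: w)
  case 0
  then show ?case by (intro exI[of _ "[]"]) simp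
next
  case (Suc N)
  then obtain u where u: "(w, u) \<in> g" "(u, v) \<in> g ^^ N"
    by (meson relpow_Suc_E2)
  obtain ys where "successively (\<lambda>x y. (x, y) \<in> g) (u # ys)" "last (u # ys) = v"
    using Suc.IH[OF u(2)] by blast
  with u(1) show ?case by (intro exI[of _ "u # ys"]) simp
qed

text \<open>
  A state is the part of the path that is already planned; when only its last world is left, the
  plan is renewed by a block starting there.
\<close>

definition advance :: "('w \<Rightarrow> 'w list) \<Rightarrow> 'w list \<Rightarrow> 'w list" where
  "advance b s = (if tl s = [] then tl (b (hd s)) else tl s)"

text \<open>Each advance drops the head of the plan, so every planned world becomes the head at some
  later time; \<open>p\<close> records these heads. The condition on \<open>tl\<close> keeps a
  renewed plan nonempty. The conclusion also covers the block at \<open>last s\<close>, because an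
  eventuality that the plan \<open>s\<close> leaves unfulfilled is still pending there.\<close>

lemma concat_blocks:
  fixes P :: "'w \<Rightarrow> 'w \<Rightarrow> bool" and b :: "'w \<Rightarrow> 'w list"
  assumes block: "\<And>w. w \<in> W \<Longrightarrow> tl (b w) \<noteq> [] \<and> hd (b w) = w \<and> successively P (b w) \<and> set (b w) \<subseteq> W"
    and "w \<in> W"
  shows "\<exists>p. p 0 = w \<and> (\<forall>n. P (p n) (p (Suc n))) \<and>
    (\<forall>n. \<exists>s. s \<noteq> [] \<and> hd s = p n \<and> successively P s \<and> set s \<subseteq> W \<and>
           set s \<union> set (b (last s)) \<subseteq> p ` {n..})"
proof -
  \<comment> \<open>The one-world plan \<open>[w]\<close> makes the first advance open the block at
    \<open>w\<close>.\<close>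
  define st where "st n = (advance b ^^ n) [w]" for n
  define p where "p n = hd (st n)" for n
  have st_Suc: "st (Suc n) = advance b (st n)" for n
    by (simp add: st_def)
  have inv: "st n \<noteq> [] \<and> successively P (st n) \<and> set (st n) \<subseteq> W" for n
  proof (induction n)
    case 0
    show ?case using \<open>w \<in> W\<close> by (simp add: st_def)
  next
    case (Suc n)
    obtain a s where s: "st n = a # s" using Suc by (cases "st n") auto
    obtain c t where t: "b a = c # t" "t \<noteq> []" using block[of a] Suc s by (cases "b a") auto
    show ?case
      using Suc block[of a] s t by (auto simp: st_Suc advance_def successively_Cons)
  qed
  have P: "P (p n) (p (Suc n))" for n
  proof -
    obtain a s where s: "st n = a # s" using inv[of n] by (cases "st n") auto
    obtain c t where t: "b a = c # t" "t \<noteq> []" using block[of a] inv[of n] s by (cases "b a") auto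
    show ?thesis
      using inv[of n] block[of a] s t by (auto simp: p_def st_Suc advance_def successively_Cons)
  qed
  have planned: "set s \<union> set (b (last s)) \<subseteq> p ` {n..}" if "st n = s" for n s
  proof -
    have tail: "p n \<in> p ` {n..}" "p ` {Suc n..} \<subseteq> p ` {n..}" for n
      by auto
    \<comment> \<open>The tail of a plan with at least two worlds is the plan at the next time, so
      induction on the plan moves from \<open>n\<close> to \<open>Suc n\<close>, here and in the
      induction below.\<close>
    have sub_set: "set s \<subseteq> p ` {n..}" if "st n = s" for n s
      using that
    proof (induction s arbitrary: n)
      case (Cons a s)
      have "set s \<subseteq> p ` {Suc n..}"
        using Cons by (cases "s = []") (auto simp: st_Suc advance_def)
      moreover have "a = p n" by (simp add: p_def Cons.prems)
      ultimately show ?case using tail[of n] by simp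
    qed simp
    show ?thesis
      using that inv[of n]
    proof (induction s arbitrary: n)
      case (Cons a s)
      show ?case
      proof (cases "s = []")
        \<comment> \<open>Only \<open>a\<close> is left, so the next plan is
          \<open>tl (b a)\<close>; the missing head of the block is \<open>a\<close> itself, visited
          at time \<open>n\<close>.\<close>
        case True
        then have "set (tl (b a)) \<subseteq> p ` {Suc n..}"
          using sub_set[of "Suc n"] Cons.prems(1) by (simp add: st_Suc advance_def)
        moreover have "a = p n" by (simp add: p_def Cons.prems(1))
        moreover have "b a = a # tl (b a)"
          using block[of a] Cons.prems by (cases "b a") auto
        ultimately have "set (b a) \<subseteq> p ` {n..}"
          using tail[of n] by (metis insert_subset list.simps(15) order_trans)
        then show ?thesis using True tail(1)[of n] \<open>a = p n\<close> by simp
      next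
        case False
        then have "set s \<union> set (b (last s)) \<subseteq> p ` {Suc n..}"
          using Cons.IH[of "Suc n"] Cons.prems(1) inv[of "Suc n"] by (simp add: st_Suc advance_def)
        moreover have "set (a # s) \<subseteq> p ` {n..}" using sub_set[OF Cons.prems(1)] .
        ultimately show ?thesis using False tail(2)[of n] by auto
      qed
    qed simp
  qed
  show ?thesis
  proof (intro exI[of _ p] conjI allI)
    show "p 0 = w" by (simp add: p_def st_def)
    show "P (p n) (p (Suc n))" for n by (rule P)
    show "\<exists>s. s \<noteq> [] \<and> hd s = p n \<and> successively P s \<and> set s \<subseteq> W \<and>
      set s \<union> set (b (last s)) \<subseteq> p ` {n..}" for n
      using inv[of n] planned[of n "st n"] by (intro exI[of _ "st n"]) (simp add: p_def)
  qed
qed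

section \<open>Types along the steps of a quasimodel\<close>

context
  fixes \<phi> :: "'p fm" and D :: "('w, 'p) quasi"
  assumes qm: "quasimodel \<phi> D"
begin

abbreviation "g_path \<equiv> successively (\<lambda>x y. (x, y) \<in> step D)"

lemma step_worlds: "(x, y) \<in> step D \<Longrightarrow> x \<in> worlds D \<and> y \<in> worlds D"
  using qm unfolding quasimodel_def omega_sensible_def sensible_def by blast

lemma acc_worlds: "(x, y) \<in> acc D \<Longrightarrow> x \<in> worlds D \<and> y \<in> worlds D"
  using qm unfolding quasimodel_def typed_frame_def by blast

lemma realizing_worlds: "w \<in> realizing_paths \<phi> D \<Longrightarrow> w n \<in> worlds D"
  unfolding realizing_paths_def realizing_def infinite_path_def using step_worlds by blast

lemma step_total: "w \<in> worlds D \<Longrightarrow> \<exists>v. (w, v) \<in> step D"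
  using qm unfolding quasimodel_def omega_sensible_def sensible_def by blast

lemma step_sensible: "(x, y) \<in> step D \<Longrightarrow> sensible_pair \<phi> (type_of D x) (type_of D y)"
  using qm unfolding quasimodel_def omega_sensible_def sensible_def by blast

lemma Neg_in_type:
  assumes "w \<in> worlds D" "\<psi> \<in> sub \<phi>"
  shows "Neg \<psi> \<in>\<^sub>d type_of D w \<longleftrightarrow> \<not> \<psi> \<in>\<^sub>d type_of D w"
proof -
  have "is_type \<phi> (type_of D w)"
    using qm assms(1) unfolding quasimodel_def typed_frame_def by blast
  moreover have "\<psi> \<in>\<^sub>d sub_pm \<phi>"
    using assms(2) by (simp add: sub_pm_def)
  ultimately show ?thesis
    unfolding is_type_def by blast
qed

lemma And_in_type:
  assumes "w \<in> worlds D" "And \<alpha> \<beta> \<in> sub \<phi>"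
  shows "And \<alpha> \<beta> \<in>\<^sub>d type_of D w \<longleftrightarrow> \<alpha> \<in>\<^sub>d type_of D w \<and> \<beta> \<in>\<^sub>d type_of D w"
proof -
  have "is_type \<phi> (type_of D w)"
    using qm assms(1) unfolding quasimodel_def typed_frame_def by blast
  moreover have "And \<alpha> \<beta> \<in>\<^sub>d sub_pm \<phi>"
    unfolding sub_pm_def using assms(2) by blast
  ultimately show ?thesis
    unfolding is_type_def by blast
qed

lemma Box_in_type:
  assumes "w \<in> worlds D" "Box \<alpha> \<in> sub \<phi>"
  shows "Box \<alpha> \<in>\<^sub>d type_of D w \<longleftrightarrow> (\<forall>v. (w, v) \<in> acc D \<longrightarrow> \<alpha> \<in>\<^sub>d type_of D v)"
proof -
  have "Box \<alpha> \<in>\<^sub>d sub_pm \<phi>"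
    unfolding sub_pm_def using assms(2) by blast
  then show ?thesis
    using qm assms(1) unfolding quasimodel_def typed_frame_def by blast
qed

text \<open>Otherwise \<open>x\<close> would have \<psi> and \<open>y\<close> would have
  \<open>Star\<close> \<psi>, and the fixpoint clause of a sensible pair would put
  \<open>Star\<close> \<psi> into the type of \<open>x\<close>.\<close>

lemma Neg_Star_persists:
  assumes "Star \<psi> \<in> sub \<phi>" "(x, y) \<in> step D" "Neg (Star \<psi>) \<in>\<^sub>d type_of D x"
  shows "Neg \<psi> \<in>\<^sub>d type_of D x \<or> Neg (Star \<psi>) \<in>\<^sub>d type_of D y"
  using assms step_sensible[OF assms(2)] step_worlds[OF assms(2)]
    Neg_in_type[of x \<psi>] Neg_in_type[of x "Star \<psi>"] Neg_in_type[of y "Star \<psi>"]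
    sub_immediate(6)[OF assms(1)]
  unfolding sensible_pair_def by blast

lemma Neg_Star_persists_path:
  assumes "Star \<psi> \<in> sub \<phi>" "g_path s" "s \<noteq> []" "Neg (Star \<psi>) \<in>\<^sub>d type_of D (hd s)"
  shows "(\<exists>x\<in>set s. Neg \<psi> \<in>\<^sub>d type_of D x) \<or> Neg (Star \<psi>) \<in>\<^sub>d type_of D (last s)"
  using assms(2-)
proof (induction s)
  case (Cons a s)
  show ?case
  proof (cases "s = []")
    case True
    then show ?thesis using Cons.prems by simp
  next
    case False
    then show ?thesis
      using Cons Neg_Star_persists[OF assms(1), of a "hd s"] by (auto simp: successively_Cons)
  qed
qed simp

section \<open>Existence of realizing paths\<close>

lemma g_path_worlds:
  assumes "g_path s" "hd s \<in> worlds D"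
  shows "set s \<subseteq> worlds D"
  using assms
proof (induction s)
  case (Cons a s)
  then show ?case
    using step_worlds by (cases "s = []") (auto simp: successively_Cons)
qed simp

text \<open>Induction on \<open>S\<close> extends one path eventuality by eventuality. An
  eventuality missed so far has persisted to the last world, where omega-sensibility supplies a
  finite continuation fulfilling it; appending this preserves what was fulfilled before. The empty
  case already takes one step, to make the tail nonempty.\<close>

lemma ex_fulfilling_block:
  assumes "finite S" "S \<subseteq> {\<psi>. Star \<psi> \<in> sub \<phi>}" "w \<in> worlds D"
  shows "\<exists>s. tl s \<noteq> [] \<and> hd s = w \<and> g_path s \<and>
    (\<forall>\<psi>\<in>S. Neg (Star \<psi>) \<in>\<^sub>d type_of D w \<longrightarrow> (\<exists>x\<in>set s. Neg \<psi> \<in>\<^sub>d type_of D x))"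
  using assms(1,2)
proof (induction S)
  case empty
  obtain v where "(w, v) \<in> step D" using step_total[OF assms(3)] by blast
  then show ?case by (intro exI[of _ "[w, v]"]) simp
next
  case (insert \<psi> S)
  then obtain s where s: "tl s \<noteq> []" "hd s = w" "g_path s"
    "\<forall>\<psi>\<in>S. Neg (Star \<psi>) \<in>\<^sub>d type_of D w \<longrightarrow> (\<exists>x\<in>set s. Neg \<psi> \<in>\<^sub>d type_of D x)"
    by auto
  have \<psi>: "Star \<psi> \<in> sub \<phi>" using insert.prems by simp
  have ne: "s \<noteq> []" using s(1) by auto
  show ?case
  proof (cases "Neg (Star \<psi>) \<in>\<^sub>d type_of D w \<longrightarrow> (\<exists>x\<in>set s. Neg \<psi> \<in>\<^sub>d type_of D x)")
    case True
    then show ?thesis using s by (intro exI[of _ s]) blast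
  next
    case False
    then have "Neg (Star \<psi>) \<in>\<^sub>d type_of D (last s)"
      using Neg_Star_persists_path[OF \<psi> s(3) ne] s(2) by blast
    moreover have "last s \<in> worlds D"
      using g_path_worlds[OF s(3)] s(2) assms(3) ne by auto
    ultimately obtain v N where v: "(last s, v) \<in> step D ^^ N" "Neg \<psi> \<in>\<^sub>d type_of D v"
      using qm \<psi> unfolding quasimodel_def omega_sensible_def by blast
    \<comment> \<open>\<open>ys\<close> leaves out its starting world \<open>last s\<close>, so
      \<open>s @ ys\<close> does not repeat the junction.\<close>
    obtain ys where ys: "g_path (last s # ys)" "last (last s # ys) = v"
      using relpow_imp_successively[OF v(1)] by blast
    have "v \<in> set (s @ ys)" using ys(2) ne by (auto split: if_splits)
    moreover have "g_path (s @ ys)"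
      using s(3) ys(1) by (auto simp: successively_append_iff successively_Cons)
    moreover have "tl (s @ ys) \<noteq> []" "hd (s @ ys) = w" using s ne by auto
    ultimately show ?thesis using s(4) v(2)
      by (intro exI[of _ "s @ ys"]) (auto simp del: dn.simps)
  qed
qed

lemma ex_realizing_path:
  assumes "w \<in> worlds D"
  shows "\<exists>p \<in> realizing_paths \<phi> D. p 0 = w"
proof -
  \<comment> \<open>Finiteness allows \<open>S\<close> to be the set of all \<psi> with
    \<open>Star\<close> \<psi> a subformula of \<phi>; \<open>b\<close> chooses one such block for
    every world.\<close>
  obtain b where b: "\<And>w. w \<in> worlds D \<Longrightarrow> tl (b w) \<noteq> [] \<and> hd (b w) = w \<and> g_path (b w) \<and>
    (\<forall>\<psi>. Star \<psi> \<in> sub \<phi> \<longrightarrow> Neg (Star \<psi>) \<in>\<^sub>d type_of D w \<longrightarrow>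
       (\<exists>x\<in>set (b w). Neg \<psi> \<in>\<^sub>d type_of D x))"
    using ex_fulfilling_block[OF finite_Star_sub[of \<phi>] order_refl]
    by (simp only: mem_Collect_eq Ball_def) metis
  have block: "tl (b w) \<noteq> [] \<and> hd (b w) = w \<and> g_path (b w) \<and> set (b w) \<subseteq> worlds D"
    if "w \<in> worlds D" for w
    using b[OF that] g_path_worlds[of "b w"] that by simp
  obtain p where p: "p 0 = w" "\<And>n. (p n, p (Suc n)) \<in> step D"
    "\<And>n. \<exists>s. s \<noteq> [] \<and> hd s = p n \<and> g_path s \<and> set s \<subseteq> worlds D \<and>
       set s \<union> set (b (last s)) \<subseteq> p ` {n..}"
    using concat_blocks[of "worlds D" b, OF block assms] by blast
  have "\<exists>K\<ge>n. Neg \<psi> \<in>\<^sub>d type_of D (p K)"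
    if \<psi>: "Star \<psi> \<in> sub \<phi>" "Neg (Star \<psi>) \<in>\<^sub>d type_of D (p n)" for n \<psi>
  proof -
    obtain s where s: "s \<noteq> []" "hd s = p n" "g_path s" "set s \<subseteq> worlds D"
      "set s \<union> set (b (last s)) \<subseteq> p ` {n..}"
      using p(3) by blast
    have "last s \<in> worlds D" using s(1,4) by auto
    moreover have "Neg (Star \<psi>) \<in>\<^sub>d type_of D (hd s)" using \<psi>(2) s(2) by simp
    \<comment> \<open>Either the plan \<open>s\<close> fulfils the eventuality, or it survives to
      \<open>last s\<close> and the next block fulfils it; \<open>p\<close> visits both from time
      \<open>n\<close> on.\<close>
    ultimately have "\<exists>x \<in> set s \<union> set (b (last s)). Neg \<psi> \<in>\<^sub>d type_of D x"
      using Neg_Star_persists_path[OF \<psi>(1) s(3,1)] \<psi>(1) b by blast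
    with s(5) show ?thesis by blast
  qed
  with p show ?thesis
    unfolding realizing_paths_def realizing_def infinite_path_def by blast
qed

section \<open>Copying initial segments of realizing paths\<close>

lemma realizing_prepend:
  assumes "p \<in> realizing_paths \<phi> D" "(x, p 0) \<in> step D"
  shows "case_nat x p \<in> realizing_paths \<phi> D"
proof -
  have later: "\<exists>K\<ge>n. Neg \<psi> \<in>\<^sub>d type_of D (p K)"
    if "Star \<psi> \<in> sub \<phi>" "Neg (Star \<psi>) \<in>\<^sub>d type_of D (p n)" for \<psi> n
    using assms(1) that unfolding realizing_paths_def realizing_def by blast
  have "\<exists>K\<ge>n. Neg \<psi> \<in>\<^sub>d type_of D (case_nat x p K)"
    if \<psi>: "Star \<psi> \<in> sub \<phi>" "Neg (Star \<psi>) \<in>\<^sub>d type_of D (case_nat x p n)" for \<psi> n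
  \<comment> \<open>The only new position is 0: its eventualities are fulfilled at \<open>x\<close>
    or pass on to \<open>p 0\<close>.\<close>
  proof (cases "n = 0 \<and> Neg \<psi> \<in>\<^sub>d type_of D x")
    case True
    then show ?thesis by (intro exI[of _ 0]) (simp del: dn.simps)
  next
    case False
    \<comment> \<open>Truncated subtraction gives \<open>n - 1 = 0\<close> for \<open>n = 0\<close>
      too, so one index covers an eventuality passed on from \<open>x\<close> and one already
      pending on \<open>p\<close>.\<close>
    then have "Neg (Star \<psi>) \<in>\<^sub>d type_of D (p (n - 1))"
      using Neg_Star_persists[OF \<psi>(1) assms(2)] \<psi>(2) by (cases n) (auto simp del: dn.simps)
    then obtain K where "K \<ge> n - 1" "Neg \<psi> \<in>\<^sub>d type_of D (p K)"
      using later \<psi>(1) by blast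
    then show ?thesis by (intro exI[of _ "Suc K"]) (auto simp del: dn.simps)
  qed
  moreover have "(case_nat x p n, case_nat x p (Suc n)) \<in> step D" for n
    using assms by (cases n) (auto simp: realizing_paths_def realizing_def infinite_path_def)
  ultimately show ?thesis
    unfolding realizing_paths_def realizing_def infinite_path_def by blast
qed

text \<open>The up-set of \<open>w'\<close> is open, so by continuity its preimage under
  \<open>step D\<close> is upward closed; it contains \<open>w\<close> and hence
  \<open>v\<close>.\<close>

lemma step_forth:
  assumes "(w, w') \<in> step D" "(w, v) \<in> acc D"
  shows "\<exists>v'. (v, v') \<in> step D \<and> (w', v') \<in> acc D"
proof -
  let ?T = "upset_topology (worlds D) (acc D)" and ?U = "acc D `` {w'}"
  have tr: "trans (acc D)" and "refl_on (worlds D) (acc D)"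
    using qm by (auto simp: quasimodel_def typed_frame_def)
  then have "w' \<in> ?U"
    using step_worlds[OF assms(1)] by (auto dest: refl_onD)
  have "openin ?T ?U"
    unfolding openin_upset_topology using tr acc_worlds by (auto dest: transD)
  then have "openin ?T ((step D)\<inverse> `` ?U)"
    using qm unfolding quasimodel_def omega_sensible_def sensible_def continuous_rel_def by blast
  moreover have "w \<in> (step D)\<inverse> `` ?U"
    using assms(1) \<open>w' \<in> ?U\<close> by blast
  ultimately have "v \<in> (step D)\<inverse> `` ?U"
    using assms(2) acc_worlds[OF assms(2)] unfolding openin_upset_topology by blast
  then show ?thesis by blast
qed

text \<open>This serves the \<open>Box\<close> case. \<open>step_forth\<close> copies the first step
  of \<open>w\<close> above itself from \<open>v\<close>, the induction hypothesis copies the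
  shifted path, and prepending \<open>v\<close> keeps the result realizing.\<close>

lemma basic_open_hits:
  assumes "w \<in> realizing_paths \<phi> D" "(w 0, v) \<in> acc D"
  shows "\<exists>p \<in> basic_open \<phi> D N w. p 0 = v"
  using assms
proof (induction N arbitrary: w v)
  case 0
  \<comment> \<open>For \<open>N = 0\<close> only the first world is constrained, so any realizing
    path from \<open>v\<close> will do.\<close>
  then obtain p where "p \<in> realizing_paths \<phi> D" "p 0 = v"
    using ex_realizing_path acc_worlds by blast
  with 0 show ?case by (auto simp: basic_open_def)
next
  case (Suc N)
  have "(w 0, w 1) \<in> step D"
    using Suc.prems(1) by (simp add: realizing_paths_def realizing_def infinite_path_def)
  then obtain v' where v': "(v, v') \<in> step D" "(w 1, v') \<in> acc D"
    using step_forth Suc.prems(2) by blast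
  then obtain p where p: "p \<in> basic_open \<phi> D N (shift w)" "p 0 = v'"
    using Suc.IH[OF shift_realizing[OF Suc.prems(1)], of v'] by (auto simp: shift_def)
  then have "case_nat v p \<in> realizing_paths \<phi> D"
    using v'(1) by (intro realizing_prepend) (auto simp: basic_open_def)
  moreover have "(w n, case_nat v p n) \<in> acc D" if "n \<le> Suc N" for n
    using that p(1) Suc.prems(2) by (cases n) (auto simp: basic_open_def shift_def)
  ultimately show ?case
    by (intro bexI[of _ "case_nat v p"]) (auto simp: basic_open_def)
qed

section \<open>Truth in the limit model\<close>

lemma shift_funpow: "(shift ^^ n) w k = w (n + k)"
  by (induction n arbitrary: k) (simp_all add: shift_def)

lemma shift_funpow_realizing:
  "w \<in> realizing_paths \<phi> D \<Longrightarrow> (shift ^^ n) w \<in> realizing_paths \<phi> D"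
  by (induction n) (simp_all add: shift_realizing)

text \<open>From left to right, the fixpoint clause carries \<open>Star\<close> \<psi> along the
  path. The converse rests on \<open>w\<close> being realizing: a pending eventuality at
  \<open>w 0\<close> would force the negation of \<psi> at some \<open>w K\<close>.\<close>

lemma Star_in_type:
  assumes "w \<in> realizing_paths \<phi> D" "Star \<psi> \<in> sub \<phi>"
  shows "Star \<psi> \<in>\<^sub>d type_of D (w 0) \<longleftrightarrow> (\<forall>n. \<psi> \<in>\<^sub>d type_of D (w n))"
proof
  have st: "(w n, w (Suc n)) \<in> step D" for n
    using assms(1) by (simp add: realizing_paths_def realizing_def infinite_path_def)
  have unfold: "Star \<psi> \<in>\<^sub>d type_of D (w n) \<longleftrightarrow>
      \<psi> \<in>\<^sub>d type_of D (w n) \<and> Star \<psi> \<in>\<^sub>d type_of D (w (Suc n))" for n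
    using step_sensible[OF st] assms(2) unfolding sensible_pair_def by blast
  assume *: "Star \<psi> \<in>\<^sub>d type_of D (w 0)"
  have "Star \<psi> \<in>\<^sub>d type_of D (w n)" for n
    by (induction n) (use * unfold in blast)+
  then show "\<forall>n. \<psi> \<in>\<^sub>d type_of D (w n)"
    using unfold by blast
next
  assume *: "\<forall>n. \<psi> \<in>\<^sub>d type_of D (w n)"
  then have "\<not> Neg (Star \<psi>) \<in>\<^sub>d type_of D (w 0)"
    using assms Neg_in_type[OF realizing_worlds sub_immediate(6)]
    unfolding realizing_paths_def realizing_def by blast
  then show "Star \<psi> \<in>\<^sub>d type_of D (w 0)"
    using Neg_in_type[OF realizing_worlds] assms by blast
qed

text \<open>The path is generalized in the induction because \<open>Next\<close> and
  \<open>Star\<close> refer to shifted paths and \<open>Box\<close> to neighbouring ones.\<close>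

lemma truth_lemma:
  assumes "\<psi> \<in> sub \<phi>" "w \<in> realizing_paths \<phi> D"
  shows "w \<in> ext (limit_model \<phi> D) \<psi> \<longleftrightarrow> \<psi> \<in>\<^sub>d type_of D (w 0)"
  using assms
proof (induction \<psi> arbitrary: w)
  case (Var p)
  then show ?case by (simp add: limit_model_def)
next
  case (And \<alpha> \<beta>)
  then show ?case
    using And_in_type[OF realizing_worlds] sub_immediate(1,2)[OF And.prems(1)]
    by (simp del: dn.simps)
next
  case (Neg \<alpha>)
  then show ?case
    using Neg_in_type[OF realizing_worlds sub_immediate(3)] sub_immediate(3)[OF Neg.prems(1)]
    by (simp add: limit_model_def topspace_limit_topology[OF qm] del: dn.simps)
next
  case (Box \<alpha>)
  let ?E = "ext (limit_model \<phi> D) \<alpha>"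
  have IH: "v \<in> ?E \<longleftrightarrow> \<alpha> \<in>\<^sub>d type_of D (v 0)" if "v \<in> realizing_paths \<phi> D" for v
    using Box.IH sub_immediate(4)[OF Box.prems(1)] that by blast
  have basic: "basic_open \<phi> D N w \<subseteq> realizing_paths \<phi> D" for N w
    by (auto simp: basic_open_def)
  \<comment> \<open>The basic sets centred at \<open>w\<close> are open, contain \<open>w\<close>,
    and every open set around \<open>w\<close> includes one of them, so they suffice to test the
    interior.\<close>
  have "w \<in> ext (limit_model \<phi> D) (Box \<alpha>) \<longleftrightarrow> (\<exists>N. basic_open \<phi> D N w \<subseteq> ?E)"
  proof
    assume "w \<in> ext (limit_model \<phi> D) (Box \<alpha>)"
    then obtain U where "openin (limit_topology \<phi> D) U" "w \<in> U" "U \<subseteq> ?E"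
      by (auto simp: interior_of_def limit_model_def)
    then show "\<exists>N. basic_open \<phi> D N w \<subseteq> ?E"
      unfolding openin_limit_topology[OF qm] by blast
  next
    assume "\<exists>N. basic_open \<phi> D N w \<subseteq> ?E"
    then obtain N where N: "basic_open \<phi> D N w \<subseteq> ?E" by blast
    have "openin (limit_topology \<phi> D) (basic_open \<phi> D N w)"
      unfolding openin_limit_topology[OF qm]
      using basic basic_open_mono[OF qm _ order_refl] by blast
    moreover have "space (limit_model \<phi> D) = limit_topology \<phi> D"
      by (simp add: limit_model_def)
    ultimately show "w \<in> ext (limit_model \<phi> D) (Box \<alpha>)"
      using N basic_open_self[OF qm Box.prems(2)] by (auto simp: interior_of_def)
  qed
  also have "\<dots> \<longleftrightarrow> (\<forall>v. (w 0, v) \<in> acc D \<longrightarrow> \<alpha> \<in>\<^sub>d type_of D v)"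
  proof
    \<comment> \<open>Every successor \<open>v\<close> of \<open>w 0\<close> starts some path in the
      neighbourhood, and the induction hypothesis reads the truth of \<alpha> on that path off the
      type of \<open>v\<close>.\<close>
    assume "\<exists>N. basic_open \<phi> D N w \<subseteq> ?E"
    then show "\<forall>v. (w 0, v) \<in> acc D \<longrightarrow> \<alpha> \<in>\<^sub>d type_of D v"
      using basic_open_hits[OF Box.prems(2)] IH basic by blast
  next
    \<comment> \<open>The neighbourhood with \<open>N = 0\<close> suffices, since the truth of
      \<alpha> at a path depends only on its first world.\<close>
    assume "\<forall>v. (w 0, v) \<in> acc D \<longrightarrow> \<alpha> \<in>\<^sub>d type_of D v"
    then have "basic_open \<phi> D 0 w \<subseteq> ?E"
      using IH by (auto simp: basic_open_def)
    then show "\<exists>N. basic_open \<phi> D N w \<subseteq> ?E" ..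
  qed
  also have "\<dots> \<longleftrightarrow> Box \<alpha> \<in>\<^sub>d type_of D (w 0)"
    using Box_in_type[OF realizing_worlds] Box.prems by blast
  finally show ?case .
next
  case (Next \<alpha>)
  have "(w 0, shift w 0) \<in> step D"
    using Next.prems(2)
    by (simp add: realizing_paths_def realizing_def infinite_path_def shift_def)
  then have "Next \<alpha> \<in>\<^sub>d type_of D (w 0) \<longleftrightarrow> \<alpha> \<in>\<^sub>d type_of D (shift w 0)"
    using step_sensible Next.prems(1) unfolding sensible_pair_def by blast
  moreover have "w \<in> ext (limit_model \<phi> D) (Next \<alpha>) \<longleftrightarrow> shift w \<in> ext (limit_model \<phi> D) \<alpha>"
    using Next.prems(2) by (simp add: limit_model_def topspace_limit_topology[OF qm])
  ultimately show ?case
    using Next.IH[OF sub_immediate(5)[OF Next.prems(1)] shift_realizing[OF Next.prems(2)]] by blast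
next
  case (Star \<alpha>)
  have "w \<in> ext (limit_model \<phi> D) (Star \<alpha>) \<longleftrightarrow>
      (\<forall>n. (shift ^^ n) w \<in> ext (limit_model \<phi> D) \<alpha>)"
    using Star.prems(2) by (simp add: limit_model_def topspace_limit_topology[OF qm])
  \<comment> \<open>The \<open>n\<close>-th shift of \<open>w\<close> starts at \<open>w n\<close>,
    so the induction hypothesis yields the condition of \<open>Star_in_type\<close>.\<close>
  then show ?case
    using Star.IH[OF sub_immediate(6)[OF Star.prems(1)] shift_funpow_realizing[OF Star.prems(2)]]
      Star_in_type[OF Star.prems(2,1)] by (simp add: shift_funpow del: dn.simps)
qed

end

theorem theorem4p9:
  fixes \<phi> :: "'p fm" and D :: "('w, 'p) quasi"
  assumes "quasimodel \<phi> D"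
    and "satisfied_in \<phi> D"
  shows "\<exists>w \<in> realizing_paths \<phi> D. satisfies (limit_model \<phi> D) w \<phi>"
proof -
  obtain w where "w \<in> worlds D" "\<phi> \<in>\<^sub>d type_of D w"
    using assms(2) unfolding satisfied_in_def by blast
  moreover then obtain p where "p \<in> realizing_paths \<phi> D" "p 0 = w"
    using ex_realizing_path[OF assms(1)] by blast
  ultimately show ?thesis
    using truth_lemma[OF assms(1) sub_refl] unfolding satisfies_def by blast
qed

end
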